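(* Let $M$ be a matroid with finite ground set $E$ and set of cocircuits $\mathcal{C}^*$. Let $\mathbb{P}=(R,G)$ be a skew partial field. For each $X\in\mathcal{C}^*$, let $a^X\in R^E$ be a $G$-primitive chain with $\|a^X\|=X$. Define the $R$-chain group $$C:=\Big\{\sum_{X\in\mathcal{C}^*} r_Xa^X : r_X\in R\Big\}.$$ Then $C$ is a $\mathbb{P}$-chain group with $M=M(C)$ if and only if for each modular triple $X,X',X''\in\mathcal{C}^*$ there exist $p,p',p''\in G$ such that $$pa^X+p'a^{X'}+p''a^{X''}=0.$$
   Context: A skew partial field is a pair $\mathbb{P}=(R,G)$ with $R$ a (not necessarily commutative) ring with identity and $G$ a subgroup of the units $R^*$ with $-1\in G$. An $R$-chain group on $E$ is a subset of $R^E$ containing $0$ and closed under componentwise addition and left scalar multiplication. For $c\in R^E$, $\|c\|=\{e:c_e\neq0\}$; $c$ is $G$-primitive if its entries lie in $G\cup\{0\}$. A chain $c$ of a chain group $C$ is elementary if $c\neq0$ and no nonzero chain of $C$ has support strictly contained in $\|c\|$. A $\mathbb{P}$-chain group is an $R$-chain group in which every elementary chain equals $rc'$ for some $r\in R$ and $G$-primitive $c'$ in the group; $M(C)$ is the matroid on $E$ whose cocircuits are the supports of the elementary chains of $C$. A set $\{X_1,\dots,X_k\}$ of distinct cocircuits of $M$ is a modular set if $\operatorname{rank}(M/S)=2$ where $S:=E\setminus(X_1\cup\dots\cup X_k)$; a modular triple is a modular set of three cocircuits. *)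

theory Defs
  imports "HOL-Algebra.Ring" "HOL-Library.FuncSet"
begin

section \<open>Finite matroids\<close>

record 'e matroid =
  ground :: "'e set"
  indeps :: "'e set set"

definition is_matroid :: "'e matroid \<Rightarrow> bool" where
  "is_matroid M \<longleftrightarrow>
     finite (ground M) \<and>
     indeps M \<subseteq> Pow (ground M) \<and>
     {} \<in> indeps M \<and>
     (\<forall>I J. I \<in> indeps M \<and> J \<subseteq> I \<longrightarrow> J \<in> indeps M) \<and>
     (\<forall>I J. I \<in> indeps M \<and> J \<in> indeps M \<and> card I < card J \<longrightarrow>
        (\<exists>e \<in> J - I. insert e I \<in> indeps M))"

definition bases_in :: "'e matroid \<Rightarrow> 'e set \<Rightarrow> 'e set set" where
  "bases_in M S =
     {B \<in> indeps M. B \<subseteq> S \<and> (\<forall>I \<in> indeps M. B \<subseteq> I \<and> I \<subseteq> S \<longrightarrow> I = B)}"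

definition bases :: "'e matroid \<Rightarrow> 'e set set" where
  "bases M = bases_in M (ground M)"

definition circuits :: "'e matroid \<Rightarrow> 'e set set" where
  "circuits M =
     {X. X \<subseteq> ground M \<and> X \<notin> indeps M \<and> (\<forall>Y. Y \<subset> X \<longrightarrow> Y \<in> indeps M)}"

definition dual :: "'e matroid \<Rightarrow> 'e matroid" where
  "dual M =
     \<lparr>ground = ground M,
      indeps = {I. I \<subseteq> ground M \<and> (\<exists>B \<in> bases M. I \<inter> B = {})}\<rparr>"

definition cocircuits :: "'e matroid \<Rightarrow> 'e set set" where
  "cocircuits M = circuits (dual M)"

definition contract :: "'e matroid \<Rightarrow> 'e set \<Rightarrow> 'e matroid" where
  "contract M S =
     \<lparr>ground = ground M - S,
      indeps = {I. I \<subseteq> ground M - S \<and> (\<exists>B \<in> bases_in M S. I \<union> B \<in> indeps M)}\<rparr>"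

definition rank :: "'e matroid \<Rightarrow> nat" where
  "rank M = Max (card ` indeps M)"

definition modular_set :: "'e matroid \<Rightarrow> 'e set set \<Rightarrow> bool" where
  "modular_set M \<X> \<longleftrightarrow>
     \<X> \<subseteq> cocircuits M \<and> rank (contract M (ground M - \<Union>\<X>)) = 2"

definition modular_triple :: "'e matroid \<Rightarrow> 'e set \<Rightarrow> 'e set \<Rightarrow> 'e set \<Rightarrow> bool" where
  "modular_triple M X X' X'' \<longleftrightarrow>
     X \<noteq> X' \<and> X \<noteq> X'' \<and> X' \<noteq> X'' \<and> modular_set M {X, X', X''}"


section \<open>Skew partial fields and chain groups\<close>

definition skew_partial_field :: "('r, 'm) ring_scheme \<Rightarrow> 'r set \<Rightarrow> bool" where
  "skew_partial_field R G \<longleftrightarrow>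
     ring R \<and> subgroup G (units_of R) \<and> \<ominus>\<^bsub>R\<^esub> \<one>\<^bsub>R\<^esub> \<in> G"

text \<open>
  Elements of \<open>R\<^sup>E\<close> are extensional functions, so that equality of chains is equality in HOL.
\<close>

definition chains :: "('r, 'm) ring_scheme \<Rightarrow> 'e set \<Rightarrow> ('e \<Rightarrow> 'r) set" where
  "chains R E = (E \<rightarrow>\<^sub>E carrier R)"

definition chain_zero :: "('r, 'm) ring_scheme \<Rightarrow> 'e set \<Rightarrow> 'e \<Rightarrow> 'r" where
  "chain_zero R E = (\<lambda>e\<in>E. \<zero>\<^bsub>R\<^esub>)"

definition chain_add ::
  "('r, 'm) ring_scheme \<Rightarrow> 'e set \<Rightarrow> ('e \<Rightarrow> 'r) \<Rightarrow> ('e \<Rightarrow> 'r) \<Rightarrow> 'e \<Rightarrow> 'r" where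
  "chain_add R E c d = (\<lambda>e\<in>E. c e \<oplus>\<^bsub>R\<^esub> d e)"

definition chain_smult ::
  "('r, 'm) ring_scheme \<Rightarrow> 'e set \<Rightarrow> 'r \<Rightarrow> ('e \<Rightarrow> 'r) \<Rightarrow> 'e \<Rightarrow> 'r" where
  "chain_smult R E r c = (\<lambda>e\<in>E. r \<otimes>\<^bsub>R\<^esub> c e)"

definition supp :: "('r, 'm) ring_scheme \<Rightarrow> 'e set \<Rightarrow> ('e \<Rightarrow> 'r) \<Rightarrow> 'e set" where
  "supp R E c = {e \<in> E. c e \<noteq> \<zero>\<^bsub>R\<^esub>}"

definition primitive_chain ::
  "('r, 'm) ring_scheme \<Rightarrow> 'r set \<Rightarrow> 'e set \<Rightarrow> ('e \<Rightarrow> 'r) \<Rightarrow> bool" where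
  "primitive_chain R G E c \<longleftrightarrow> c \<in> chains R E \<and> (\<forall>e \<in> E. c e \<in> G \<union> {\<zero>\<^bsub>R\<^esub>})"

definition chain_group ::
  "('r, 'm) ring_scheme \<Rightarrow> 'e set \<Rightarrow> ('e \<Rightarrow> 'r) set \<Rightarrow> bool" where
  "chain_group R E C \<longleftrightarrow>
     C \<subseteq> chains R E \<and>
     chain_zero R E \<in> C \<and>
     (\<forall>c \<in> C. \<forall>d \<in> C. chain_add R E c d \<in> C) \<and>
     (\<forall>r \<in> carrier R. \<forall>c \<in> C. chain_smult R E r c \<in> C)"

definition elementary_chains ::
  "('r, 'm) ring_scheme \<Rightarrow> 'e set \<Rightarrow> ('e \<Rightarrow> 'r) set \<Rightarrow> ('e \<Rightarrow> 'r) set" where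
  "elementary_chains R E C =
     {c \<in> C. c \<noteq> chain_zero R E \<and>
        \<not> (\<exists>d \<in> C. d \<noteq> chain_zero R E \<and> supp R E d \<subset> supp R E c)}"

definition pf_chain_group ::
  "('r, 'm) ring_scheme \<Rightarrow> 'r set \<Rightarrow> 'e set \<Rightarrow> ('e \<Rightarrow> 'r) set \<Rightarrow> bool" where
  "pf_chain_group R G E C \<longleftrightarrow>
     chain_group R E C \<and>
     (\<forall>c \<in> elementary_chains R E C.
        \<exists>r \<in> carrier R. \<exists>c' \<in> C. primitive_chain R G E c' \<and> c = chain_smult R E r c')"

text \<open>
  The relation \<open>M = M(C)\<close>. It determines \<open>M\<close> by lemma \<open>is_matroid_of_unique\<close> below.
\<close>

definition is_matroid_of ::
  "('r, 'm) ring_scheme \<Rightarrow> 'e set \<Rightarrow> ('e \<Rightarrow> 'r) set \<Rightarrow> 'e matroid \<Rightarrow> bool" where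
  "is_matroid_of R E C M \<longleftrightarrow>
     is_matroid M \<and> ground M = E \<and> cocircuits M = supp R E ` elementary_chains R E C"

definition chain_span ::
  "('r, 'm) ring_scheme \<Rightarrow> 'e set \<Rightarrow> 'i set \<Rightarrow> ('i \<Rightarrow> 'e \<Rightarrow> 'r) \<Rightarrow> ('e \<Rightarrow> 'r) set" where
  "chain_span R E A a =
     {(\<lambda>e\<in>E. \<Oplus>\<^bsub>R\<^esub>X\<in>A. r X \<otimes>\<^bsub>R\<^esub> a X e) | r. r \<in> A \<rightarrow> carrier R}"


section \<open>A matroid is determined by its ground set and cocircuits\<close>

lemma indeps_dual_iff:
  assumes "is_matroid M"
  shows "I \<in> indeps (dual M) \<longleftrightarrow> I \<subseteq> ground M \<and> (\<forall>X \<in> cocircuits M. \<not> X \<subseteq> I)"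
proof (intro iffI conjI ballI notI)
  assume I: "I \<in> indeps (dual M)"
  then show "I \<subseteq> ground M" by (simp add: dual_def)
  fix X assume X: "X \<in> cocircuits M" "X \<subseteq> I"
  from I X(2) have "X \<in> indeps (dual M)" unfolding dual_def by auto
  with X(1) show False by (simp add: cocircuits_def circuits_def)
next
  assume I: "I \<subseteq> ground M \<and> (\<forall>X \<in> cocircuits M. \<not> X \<subseteq> I)"
  have fin: "finite I" using I assms by (auto simp: is_matroid_def intro: finite_subset)
  show "I \<in> indeps (dual M)"
  proof (rule ccontr)
    assume "I \<notin> indeps (dual M)"
    define D where "D = {Y. Y \<subseteq> I \<and> Y \<notin> indeps (dual M)}"
    have "I \<in> D" using \<open>I \<notin> indeps (dual M)\<close> by (simp add: D_def)
    moreover have "finite D" using fin by (simp add: D_def)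
    ultimately obtain X where XD: "X \<in> D" and min: "\<And>Y. Y \<in> D \<Longrightarrow> Y \<subseteq> X \<Longrightarrow> X = Y"
      using finite_has_minimal2[of D I] by auto
    then have X: "X \<subseteq> I" "X \<notin> indeps (dual M)" by (simp_all add: D_def)
    have "Y \<in> indeps (dual M)" if "Y \<subset> X" for Y
      using min[of Y] X(1) that unfolding D_def by blast
    moreover have "X \<subseteq> ground (dual M)" using X(1) I by (auto simp: dual_def)
    ultimately have "X \<in> cocircuits M"
      using X(2) unfolding cocircuits_def circuits_def by blast
    with X(1) I show False by blast
  qed
qed

lemma bases_dual_iff:
  "B \<in> bases (dual M) \<longleftrightarrow>
     B \<in> indeps (dual M) \<and> (\<forall>I \<in> indeps (dual M). B \<subseteq> I \<longrightarrow> I = B)"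
proof -
  have "I \<subseteq> ground (dual M)" if "I \<in> indeps (dual M)" for I
    using that by (simp add: dual_def)
  then show ?thesis unfolding bases_def[of "dual M"] bases_in_def by blast
qed

lemma bases_iff_dual:
  assumes "is_matroid M"
  shows "B \<in> bases M \<longleftrightarrow> B \<subseteq> ground M \<and> ground M - B \<in> bases (dual M)"
proof -
  have sub: "B \<subseteq> ground M" if "B \<in> bases M" for B
    using that by (auto simp: bases_def bases_in_def)
  have anti: "B = B'" if "B \<in> bases M" "B' \<in> bases M" "B' \<subseteq> B" for B B'
    using that by (auto simp: bases_def bases_in_def)
  show ?thesis
  proof
    assume B: "B \<in> bases M"
    have "ground M - B \<in> indeps (dual M)" using B by (auto simp: dual_def)
    moreover have "I = ground M - B" if I: "I \<in> indeps (dual M)" "ground M - B \<subseteq> I" for I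
    proof -
      obtain B' where B': "B' \<in> bases M" "I \<inter> B' = {}" "I \<subseteq> ground M"
        using I(1) by (auto simp: dual_def)
      then have "B' \<subseteq> B" using I(2) sub by blast
      with anti B B' have "B' = B" by blast
      then show ?thesis using B' I(2) by blast
    qed
    ultimately show "B \<subseteq> ground M \<and> ground M - B \<in> bases (dual M)"
      using sub[OF B] unfolding bases_dual_iff by blast
  next
    assume a: "B \<subseteq> ground M \<and> ground M - B \<in> bases (dual M)"
    then have i: "ground M - B \<in> indeps (dual M)"
      and max: "\<And>I. I \<in> indeps (dual M) \<Longrightarrow> ground M - B \<subseteq> I \<Longrightarrow> I = ground M - B"
      unfolding bases_dual_iff by blast+
    from i obtain B' where B': "B' \<in> bases M" "(ground M - B) \<inter> B' = {}"
      by (auto simp: dual_def)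
    have "ground M - B' \<in> indeps (dual M)" using B' by (auto simp: dual_def)
    then have "ground M - B' = ground M - B" using B' max by blast
    then have "B' = B" using a sub[OF B'(1)] by blast
    then show "B \<in> bases M" using B' by simp
  qed
qed

lemma indeps_iff_bases:
  assumes "is_matroid M"
  shows "I \<in> indeps M \<longleftrightarrow> (\<exists>B \<in> bases M. I \<subseteq> B)"
proof
  assume "I \<in> indeps M"
  moreover have "finite (indeps M)"
    using assms by (auto simp: is_matroid_def intro: finite_subset[where B = "Pow (ground M)"])
  ultimately obtain B where "B \<in> indeps M" "I \<subseteq> B" "\<forall>J \<in> indeps M. B \<subseteq> J \<longrightarrow> B = J"
    using finite_has_maximal2[of "indeps M" I] by auto
  moreover have "B \<subseteq> ground M" using \<open>B \<in> indeps M\<close> assms by (auto simp: is_matroid_def)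
  ultimately show "\<exists>B \<in> bases M. I \<subseteq> B"
    unfolding bases_def bases_in_def by blast
next
  assume "\<exists>B \<in> bases M. I \<subseteq> B"
  then show "I \<in> indeps M"
    using assms unfolding is_matroid_def bases_def bases_in_def by blast
qed

lemma matroid_eqI_cocircuits:
  assumes "is_matroid M" "is_matroid N" "ground M = ground N" "cocircuits M = cocircuits N"
  shows "M = N"
proof -
  have "indeps (dual M) = indeps (dual N)"
    using indeps_dual_iff[OF assms(1)] indeps_dual_iff[OF assms(2)] assms(3,4) by auto
  then have "dual M = dual N" using assms(3) by (simp add: dual_def)
  then have "bases M = bases N"
    using bases_iff_dual[OF assms(1)] bases_iff_dual[OF assms(2)] assms(3) by auto
  then have "indeps M = indeps N"
    using indeps_iff_bases[OF assms(1)] indeps_iff_bases[OF assms(2)] by auto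
  then show ?thesis using assms(3) by simp
qed

lemma is_matroid_of_unique:
  assumes "is_matroid_of R E C M" "is_matroid_of R E C N"
  shows "M = N"
  using assms by (intro matroid_eqI_cocircuits) (auto simp: is_matroid_of_def)

end

theory Submission
  imports Defs
begin

text \<open>
  Both conditions say that the support of every nonzero chain of \<open>C\<close> contains a cocircuit.
  Given this, two of the chains of a modular triple have a combination vanishing at an element
  \<open>e\<close> outside the third cocircuit; together with the complement of the triple, \<open>e\<close> spans the third
  hyperplane, so the combination is supported on the third cocircuit and is a multiple of its chain.
  Conversely, fix a base \<open>B\<close>. A cocircuit meeting \<open>B\<close> in more than one element lies in a modular
  triple with two cocircuits meeting \<open>B\<close> in fewer elements, so by induction all \<open>a\<^sup>X\<close> are
  combinations of the chains of the fundamental cocircuits of \<open>B\<close>. Hence a chain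
  vanishing on \<open>B\<close> is zero, whereas a support containing no cocircuit misses a base.
\<close>

section \<open>Rank and cocircuits\<close>

locale finite_matroid =
  fixes M :: "'e matroid"
  assumes is_matroid: "is_matroid M"
begin

text \<open>The rank of a subset, whereas \<open>rank\<close> applies to a whole matroid;
  \<open>rank_contract\<close> links the two. Elements of \<open>S\<close> outside the ground set
  contribute nothing, since independent sets avoid them.\<close>

definition rk :: "'e set \<Rightarrow> nat" where
  "rk S = Max (card ` {I \<in> indeps M. I \<subseteq> S})"

lemma finite_ground: "finite (ground M)"
  using is_matroid by (simp add: is_matroid_def)

lemma indep_subset_ground: "I \<in> indeps M \<Longrightarrow> I \<subseteq> ground M"
  using is_matroid by (auto simp: is_matroid_def)

lemma finite_indep: "I \<in> indeps M \<Longrightarrow> finite I"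
  using indep_subset_ground finite_ground finite_subset by blast

lemma empty_indep: "{} \<in> indeps M"
  using is_matroid by (simp add: is_matroid_def)

lemma indep_subset: "I \<in> indeps M \<Longrightarrow> J \<subseteq> I \<Longrightarrow> J \<in> indeps M"
  using is_matroid unfolding is_matroid_def by blast

lemma indep_augment:
  "I \<in> indeps M \<Longrightarrow> J \<in> indeps M \<Longrightarrow> card I < card J \<Longrightarrow> \<exists>e \<in> J - I. insert e I \<in> indeps M"
  using is_matroid unfolding is_matroid_def by blast

lemma finite_indeps: "finite (indeps M)"
  by (rule finite_subset[of _ "Pow (ground M)"]) (simp_all add: finite_ground indep_subset_ground subsetI)

lemma card_le_rk: "I \<in> indeps M \<Longrightarrow> I \<subseteq> S \<Longrightarrow> card I \<le> rk S"
  unfolding rk_def using finite_indeps by (intro Max_ge) auto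

lemma rk_attained: obtains I where "I \<in> indeps M" "I \<subseteq> S" "card I = rk S"
proof -
  have "rk S \<in> card ` {I \<in> indeps M. I \<subseteq> S}"
    unfolding rk_def using finite_indeps empty_indep by (intro Max_in) auto
  then show ?thesis using that by auto
qed

lemma rk_mono: "S \<subseteq> T \<Longrightarrow> rk S \<le> rk T"
  by (rule rk_attained[of S]) (use card_le_rk in \<open>metis subset_trans\<close>)

lemma rk_indep: "I \<in> indeps M \<Longrightarrow> rk I = card I"
  by (rule rk_attained[of I]) (metis antisym card_le_rk card_mono finite_indep order_refl)

text \<open>Take an inclusion-maximal independent set between \<open>I\<close> and \<open>S\<close>.
  Were it smaller than an independent set attaining \<open>rk S\<close>, augmentation would enlarge
  it inside \<open>S\<close>.\<close>

lemma extend_to_rk: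
  assumes "I \<in> indeps M" "I \<subseteq> S"
  obtains J where "J \<in> indeps M" "I \<subseteq> J" "J \<subseteq> S" "card J = rk S"
proof -
  let ?D = "{J \<in> indeps M. I \<subseteq> J \<and> J \<subseteq> S}"
  have "finite ?D" using finite_indeps by simp
  then obtain J where J: "J \<in> ?D" and max: "\<And>K. K \<in> ?D \<Longrightarrow> J \<subseteq> K \<Longrightarrow> J = K"
    using finite_has_maximal2[of ?D I] assms by auto
  have "card J = rk S"
  proof (rule ccontr)
    assume ne: "card J \<noteq> rk S"
    obtain L where L: "L \<in> indeps M" "L \<subseteq> S" "card L = rk S" by (rule rk_attained)
    have "card J < card L" using card_le_rk[of J S] J L ne by auto
    then obtain e where e: "e \<in> L - J" "insert e J \<in> indeps M"
      using indep_augment J L by blast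
    then have "insert e J \<in> ?D" using J L by auto
    then show False using max[of "insert e J"] e by auto
  qed
  then show ?thesis using that J by auto
qed

text \<open>Replaces maximality under inclusion by a cardinality condition, the form used in all
  counting below.\<close>

lemma bases_in_iff: "B \<in> bases_in M S \<longleftrightarrow> B \<in> indeps M \<and> B \<subseteq> S \<and> card B = rk S"
proof
  assume B: "B \<in> bases_in M S"
  then have "B \<in> indeps M" "B \<subseteq> S" by (auto simp: bases_in_def)
  then obtain J where J: "J \<in> indeps M" "B \<subseteq> J" "J \<subseteq> S" "card J = rk S"
    using extend_to_rk by blast
  then have "J = B" using B by (auto simp: bases_in_def)
  then show "B \<in> indeps M \<and> B \<subseteq> S \<and> card B = rk S" using J by auto
next
  assume B: "B \<in> indeps M \<and> B \<subseteq> S \<and> card B = rk S"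
  have "I = B" if "I \<in> indeps M" "B \<subseteq> I" "I \<subseteq> S" for I
    using card_le_rk[of I S] that B finite_indep[of I] card_subset_eq[of I B]
      card_mono[of I B] by auto
  then show "B \<in> bases_in M S" using B by (auto simp: bases_in_def)
qed

text \<open>Extend a maximal independent subset \<open>I\<close> of the intersection to a maximal
  independent subset \<open>J\<close> of the union. The traces of \<open>J\<close> on
  \<open>S\<close> and \<open>T\<close> are independent, cover \<open>J\<close> and share at least
  \<open>I\<close>.\<close>

lemma rk_submodular: "rk (S \<union> T) + rk (S \<inter> T) \<le> rk S + rk T"
proof -
  obtain I where I: "I \<in> indeps M" "I \<subseteq> S \<inter> T" "card I = rk (S \<inter> T)" by (rule rk_attained)
  then obtain J where J: "J \<in> indeps M" "I \<subseteq> J" "J \<subseteq> S \<union> T" "card J = rk (S \<union> T)"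
    using extend_to_rk[of I "S \<union> T"] by blast
  have fin: "finite J" using J finite_indep by blast
  have "card (J \<inter> S) \<le> rk S" "card (J \<inter> T) \<le> rk T"
    using J(1) by (auto intro!: card_le_rk intro: indep_subset)
  moreover have "card (J \<inter> S) + card (J \<inter> T) = card ((J \<inter> S) \<union> (J \<inter> T)) + card ((J \<inter> S) \<inter> (J \<inter> T))"
    using fin by (intro card_Un_Int) auto
  moreover have "card ((J \<inter> S) \<union> (J \<inter> T)) = card J"
    using J by (intro arg_cong[where f = card]) auto
  moreover have "card I \<le> card ((J \<inter> S) \<inter> (J \<inter> T))"
    using I J fin by (intro card_mono) auto
  ultimately show ?thesis using I J by linarith
qed

lemma rk_insert_le: "rk (insert e S) \<le> Suc (rk S)"
proof -
  obtain I where I: "I \<in> indeps M" "I \<subseteq> insert e S" "card I = rk (insert e S)" by (rule rk_attained)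
  have "card (I - {e}) \<le> rk S" using I by (intro card_le_rk) (auto intro: indep_subset)
  then show ?thesis using I finite_indep[of I] card_Diff1_le[of I e]
    by (cases "e \<in> I") (auto simp: card_Diff_singleton)
qed

text \<open>The element comes from augmenting a maximal independent subset of \<open>S\<close> by
  one of \<open>T\<close>.\<close>

lemma rk_insert_strict:
  assumes "S \<subseteq> T" "rk S < rk T"
  obtains e where "e \<in> T" "e \<notin> S" "rk (insert e S) = Suc (rk S)"
proof -
  obtain I where I: "I \<in> indeps M" "I \<subseteq> S" "card I = rk S" by (rule rk_attained)
  obtain J where J: "J \<in> indeps M" "J \<subseteq> T" "card J = rk T" by (rule rk_attained)
  obtain e where e: "e \<in> J - I" "insert e I \<in> indeps M"
    using indep_augment[OF I(1) J(1)] I(3) J(3) assms(2) by auto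
  have "card (insert e I) = Suc (rk S)" using e I finite_indep by auto
  then have "Suc (rk S) \<le> rk (insert e S)"
    using card_le_rk[OF e(2), of "insert e S"] I by auto
  then have "rk (insert e S) = Suc (rk S)" using rk_insert_le[of e S] by simp
  moreover from this have "e \<notin> S" by (auto simp: insert_absorb)
  ultimately show ?thesis using that e J by auto
qed

text \<open>An independent set of the contraction together with a base of \<open>S\<close> is
  independent in \<open>M\<close>, which bounds its size. Equality is attained by extending a base
  \<open>B\<close> of \<open>S\<close> to a base \<open>D\<close> of \<open>M\<close> and removing
  \<open>B\<close>.\<close>

lemma rank_contract:
  assumes "S \<subseteq> ground M"
  shows "rank (contract M S) = rk (ground M) - rk S"
proof -
  have le: "card I \<le> rk (ground M) - rk S" if I: "I \<in> indeps (contract M S)" for I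
  proof -
    obtain B where B: "B \<in> indeps M" "B \<subseteq> S" "card B = rk S" "I \<subseteq> ground M - S" "I \<union> B \<in> indeps M"
      using I by (auto simp: contract_def bases_in_iff)
    have "card (I \<union> B) = card I + card B"
      using B finite_indep[OF B(5)] by (intro card_Un_disjoint) auto
    moreover have "card (I \<union> B) \<le> rk (ground M)"
      using B by (intro card_le_rk indep_subset_ground)
    ultimately show ?thesis using B by simp
  qed
  obtain B where B: "B \<in> indeps M" "B \<subseteq> S" "card B = rk S" by (rule rk_attained)
  then obtain D where D: "D \<in> indeps M" "B \<subseteq> D" "D \<subseteq> ground M" "card D = rk (ground M)"
    using extend_to_rk[of B "ground M"] assms by blast
  \<comment> \<open>An independent subset of \<open>S\<close> has at most \<open>rk S\<close>
    elements, so the extension \<open>D\<close> adds nothing inside \<open>S\<close>.\<close>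
  have "card (D \<inter> S) \<le> card B"
    using B D card_le_rk[of "D \<inter> S" S] by (auto intro: indep_subset)
  then have "D \<inter> S = B" using B D finite_indep[OF B(1)] finite_indep[OF D(1)]
    by (intro card_seteq[symmetric]) auto
  then have "D - B \<in> indeps (contract M S)"
    using B D by (auto simp: contract_def bases_in_iff Un_absorb2 intro!: bexI[of _ B])
  moreover have "card (D - B) = rk (ground M) - rk S"
    using B D finite_indep[OF B(1)] finite_indep[OF D(1)] by (simp add: card_Diff_subset)
  moreover have "finite (indeps (contract M S))"
    by (rule finite_subset[of _ "Pow (ground M)"]) (auto simp: contract_def finite_ground)
  ultimately show ?thesis unfolding rank_def using le by (intro Max_eqI) (auto intro: rev_image_eqI)
qed

text \<open>A set misses some base exactly when its complement is spanning.\<close>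

lemma indeps_dual_rk: "I \<in> indeps (dual M) \<longleftrightarrow> I \<subseteq> ground M \<and> rk (ground M - I) = rk (ground M)"
proof
  assume "I \<in> indeps (dual M)"
  then obtain B where B: "I \<subseteq> ground M" "I \<inter> B = {}" "B \<in> indeps M" "B \<subseteq> ground M" "card B = rk (ground M)"
    by (auto simp: dual_def bases_def bases_in_iff)
  then have "rk (ground M) \<le> rk (ground M - I)"
    using card_le_rk[of B "ground M - I"] by auto
  then show "I \<subseteq> ground M \<and> rk (ground M - I) = rk (ground M)"
    using B rk_mono[of "ground M - I" "ground M"] by auto
next
  assume *: "I \<subseteq> ground M \<and> rk (ground M - I) = rk (ground M)"
  obtain B where "B \<in> indeps M" "B \<subseteq> ground M - I" "card B = rk (ground M - I)" by (rule rk_attained)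
  then show "I \<in> indeps (dual M)"
    using * by (auto simp: dual_def bases_def bases_in_iff intro!: bexI[of _ B])
qed

section \<open>Cocircuits as complements of hyperplanes\<close>

lemma cocircuit_subset_ground: "X \<in> cocircuits M \<Longrightarrow> X \<subseteq> ground M"
  by (auto simp: cocircuits_def circuits_def dual_def)

lemma finite_cocircuits: "finite (cocircuits M)"
  by (rule finite_subset[of _ "Pow (ground M)"]) (simp_all add: finite_ground cocircuit_subset_ground subsetI)

lemma rk_hyperplane_less:
  assumes "X \<in> cocircuits M"
  shows "rk (ground M - X) < rk (ground M)"
proof -
  have "X \<notin> indeps (dual M)" using assms by (simp add: cocircuits_def circuits_def)
  then have "rk (ground M - X) \<noteq> rk (ground M)"
    using cocircuit_subset_ground[OF assms] by (simp add: indeps_dual_rk)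
  then show ?thesis using rk_mono[of "ground M - X" "ground M"] by simp
qed

lemma cocircuit_nonempty: "X \<in> cocircuits M \<Longrightarrow> X \<noteq> {}"
  using rk_hyperplane_less by fastforce

text \<open>Minimality of the cocircuit makes \<open>X - {e}\<close> independent in the dual, so its
  complement spans.\<close>

lemma rk_insert_hyperplane:
  assumes "X \<in> cocircuits M" "e \<in> X"
  shows "rk (insert e (ground M - X)) = rk (ground M)"
proof -
  have "X - {e} \<in> indeps (dual M)" using assms by (auto simp: cocircuits_def circuits_def)
  moreover have "ground M - (X - {e}) = insert e (ground M - X)"
    using assms cocircuit_subset_ground[of X] by auto
  ultimately show ?thesis by (simp add: indeps_dual_rk)
qed

lemma rk_hyperplane:
  assumes "X \<in> cocircuits M"
  shows "Suc (rk (ground M - X)) = rk (ground M)"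
proof -
  obtain e where "e \<in> X" using cocircuit_nonempty[OF assms] by auto
  then show ?thesis
    using rk_hyperplane_less[OF assms] rk_insert_hyperplane[OF assms, of e]
      rk_insert_le[of e "ground M - X"] by simp
qed

lemma cocircuit_antichain: "X \<in> cocircuits M \<Longrightarrow> Y \<in> cocircuits M \<Longrightarrow> Y \<subseteq> X \<Longrightarrow> Y = X"
  unfolding cocircuits_def circuits_def by blast

lemma cocircuit_meets_base:
  assumes "X \<in> cocircuits M" "B \<in> bases M"
  shows "X \<inter> B \<noteq> {}"
proof
  assume "X \<inter> B = {}"
  then have "X \<in> indeps (dual M)"
    using assms cocircuit_subset_ground[of X] by (auto simp: dual_def)
  then show False using assms by (simp add: cocircuits_def circuits_def)
qed

text \<open>The complement of a non-spanning set is dependent in the dual and so contains a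
  cocircuit; dually, the set lies in a hyperplane.\<close>

lemma cocircuit_avoiding_exists:
  assumes "A \<subseteq> ground M" "rk A < rk (ground M)"
  obtains X where "X \<in> cocircuits M" "X \<inter> A = {}"
proof -
  have "ground M - (ground M - A) = A" using assms by auto
  then have "ground M - A \<notin> indeps (dual M)" using assms by (simp add: indeps_dual_rk)
  then obtain X where "X \<in> cocircuits M" "X \<subseteq> ground M - A"
    using indeps_dual_iff[OF is_matroid] by auto
  then show ?thesis using that by auto
qed

text \<open>A set of corank at most one lies in at most one hyperplane. Two different hyperplanes
  have a spanning union, so by submodularity their intersection has corank at least two.\<close>

lemma cocircuit_avoiding_unique:
  assumes X: "X \<in> cocircuits M" and Y: "Y \<in> cocircuits M"
    and A: "A \<subseteq> ground M" "rk (ground M) \<le> Suc (rk A)" "X \<inter> A = {}" "Y \<inter> A = {}"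
  shows "X = Y"
proof -
  have "X \<subseteq> Y" if X: "X \<in> cocircuits M" and Y: "Y \<in> cocircuits M"
    and A: "X \<inter> A = {}" "Y \<inter> A = {}" for X Y
  proof (rule ccontr)
    assume "\<not> X \<subseteq> Y"
    then obtain e where e: "e \<in> X" "e \<notin> Y" by auto
    let ?H = "ground M - X" and ?K = "ground M - Y"
    have "rk (insert e ?H) \<le> rk (?H \<union> ?K)"
      using e cocircuit_subset_ground[OF X] by (intro rk_mono) auto
    moreover have "rk A \<le> rk (?H \<inter> ?K)" using A assms by (intro rk_mono) auto
    moreover have "Suc (rk ?H) = rk (ground M)" "Suc (rk ?K) = rk (ground M)"
      using rk_hyperplane X Y by auto
    ultimately show False
      using rk_submodular[of ?H ?K] rk_insert_hyperplane[OF X e(1)] assms(4) by linarith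
  qed
  then show ?thesis using assms by blast
qed

section \<open>Fundamental cocircuits and modular triples\<close>

lemma base_iff: "B \<in> bases M \<longleftrightarrow> B \<in> indeps M \<and> card B = rk (ground M)"
  by (metis bases_def bases_in_iff indep_subset_ground)

text \<open>Both cocircuits avoid the independent set \<open>B - {b}\<close>, which has corank
  one.\<close>

lemma fundamental_cocircuit_unique:
  assumes "B \<in> bases M" "X \<in> cocircuits M" "Y \<in> cocircuits M" "X \<inter> B = {b}" "Y \<inter> B = {b}"
  shows "X = Y"
proof (rule cocircuit_avoiding_unique)
  have B: "B \<in> indeps M" "card B = rk (ground M)" "b \<in> B" using assms by (auto simp: base_iff)
  have "rk (B - {b}) = card (B - {b})" using B by (intro rk_indep) (auto intro: indep_subset)
  then show "rk (ground M) \<le> Suc (rk (B - {b}))"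
    using B finite_indep[OF B(1)] by (simp add: card_Diff_singleton)
  show "B - {b} \<subseteq> ground M" using indep_subset_ground[OF B(1)] by auto
qed (use assms in auto)

text \<open>Inside the hyperplane \<open>?H\<close> choose an independent set \<open>F\<close> of
  corank two in \<open>M\<close> containing \<open>B \<inter> ?H\<close>. Any cocircuit avoiding
  \<open>F\<close> meets \<open>B\<close> only within \<open>X\<close>; making it also avoid an
  element of \<open>X \<inter> B\<close> makes the intersection strictly smaller.\<close>

lemma modular_triple_through:
  assumes B: "B \<in> bases M" and X: "X \<in> cocircuits M" and card: "1 < card (X \<inter> B)"
  obtains X' X'' where "modular_triple M X X' X''" "X' \<inter> B \<subset> X \<inter> B" "X'' \<inter> B \<subset> X \<inter> B"
proof -
  let ?E = "ground M" and ?H = "ground M - X"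
  have Bi: "B \<in> indeps M" "B \<subseteq> ?E" "card B = rk ?E" "finite B"
    using B indep_subset_ground[of B] finite_indep[of B] by (auto simp: base_iff)
  have "B = (X \<inter> B) \<union> (B \<inter> ?H)" using Bi by auto
  also have "card \<dots> = card (X \<inter> B) + card (B \<inter> ?H)"
    using Bi by (intro card_Un_disjoint) auto
  finally have "card B = card (X \<inter> B) + card (B \<inter> ?H)" .
  \<comment> \<open>At least two elements of \<open>B\<close> lie in \<open>X\<close>, so
    \<open>B \<inter> ?H\<close> falls short of a base of the hyperplane. This leaves room to drop
    an element \<open>j\<close> of \<open>J\<close> outside \<open>B\<close>.\<close>
  then have small: "card (B \<inter> ?H) < rk ?H" using card Bi rk_hyperplane[OF X] by linarith
  obtain J where J: "J \<in> indeps M" "B \<inter> ?H \<subseteq> J" "J \<subseteq> ?H" "card J = rk ?H"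
    using extend_to_rk[of "B \<inter> ?H" ?H] Bi by (auto intro: indep_subset)
  have "B \<inter> ?H \<noteq> J" using small J by auto
  then obtain j where j: "j \<in> J" "j \<notin> B \<inter> ?H" using J by auto
  define F where "F = J - {j}"
  have F: "F \<in> indeps M" "B \<inter> ?H \<subseteq> F" "F \<subseteq> ?H"
    using J j unfolding F_def by (auto intro: indep_subset)
  moreover have "Suc (card F) = card J"
    using j finite_indep[OF J(1)] unfolding F_def by (intro card_Suc_Diff1)
  ultimately have rkF: "Suc (rk F) = rk ?H" using J rk_indep by simp
  \<comment> \<open>An extension \<open>K\<close> of \<open>J\<close> to a base of \<open>M\<close>
    within \<open>insert b ?H\<close> must use \<open>b\<close>, so its subset
    \<open>insert b F\<close> is independent.\<close>
  have line: "rk (insert b F) = rk ?H" if b: "b \<in> X" for b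
  proof -
    obtain K where K: "K \<in> indeps M" "J \<subseteq> K" "K \<subseteq> insert b ?H" "card K = rk (insert b ?H)"
      using extend_to_rk[of J "insert b ?H"] J by blast
    have "b \<in> K"
    proof (rule ccontr)
      assume "b \<notin> K"
      then have "card K \<le> rk ?H" using K by (intro card_le_rk) auto
      then show False using K rk_insert_hyperplane[OF X b] rk_hyperplane[OF X] by simp
    qed
    then have "insert b F \<in> indeps M" using K by (auto simp: F_def intro: indep_subset)
    moreover have "b \<notin> F" using F b by auto
    ultimately show ?thesis using rk_indep F rkF finite_indep by simp
  qed
  have through: "\<exists>Y \<in> cocircuits M. Y \<inter> insert b F = {}" if b: "b \<in> X" for b
  proof -
    have "insert b F \<subseteq> ?E" using F b cocircuit_subset_ground[OF X] by auto
    moreover have "rk (insert b F) < rk ?E" using line[OF b] rk_hyperplane[OF X] by simp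
    ultimately show ?thesis by (rule cocircuit_avoiding_exists) blast
  qed
  \<comment> \<open>\<open>X'\<close> avoids \<open>b\<close>, and \<open>X''\<close> avoids an
    element \<open>b'\<close> of \<open>X'\<close>. These two elements separate the three
    cocircuits.\<close>
  obtain b where b: "b \<in> X" "b \<in> B" using cocircuit_meets_base[OF X B] by auto
  obtain X' where X': "X' \<in> cocircuits M" "X' \<inter> insert b F = {}" using through[OF b(1)] by auto
  obtain b' where b': "b' \<in> X'" "b' \<in> B" using cocircuit_meets_base[OF X'(1) B] by auto
  \<comment> \<open>Every element of \<open>B\<close> outside \<open>X\<close> lies in
    \<open>F\<close>, which \<open>X'\<close> avoids.\<close>
  have "b' \<in> X" using b' X' F Bi by auto
  then obtain X'' where X'': "X'' \<in> cocircuits M" "X'' \<inter> insert b' F = {}" using through by blast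
  have ne: "X \<noteq> X'" "X \<noteq> X''" "X' \<noteq> X''" using b b' X' X'' \<open>b' \<in> X\<close> by auto
  define S where "S = ?E - \<Union>{X, X', X''}"
  have "F \<subseteq> S" using F X' X'' by (auto simp: S_def)
  then have "rk F \<le> rk S" by (rule rk_mono)
  \<comment> \<open>If \<open>S\<close> had corank at most one, \<open>X\<close> and
    \<open>X'\<close> would coincide, as both avoid \<open>S\<close>.\<close>
  moreover have "\<not> rk ?E \<le> Suc (rk S)"
    using cocircuit_avoiding_unique[OF X X'(1), of S] ne by (auto simp: S_def)
  ultimately have "rk ?E - rk S = 2" using rkF rk_hyperplane[OF X] by linarith
  then have "modular_triple M X X' X''"
    using ne X X' X'' rank_contract[of S] by (auto simp: modular_triple_def modular_set_def S_def)
  moreover have "X' \<inter> B \<subset> X \<inter> B" "X'' \<inter> B \<subset> X \<inter> B"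
    using b b' X' X'' F Bi \<open>b' \<in> X\<close> by auto
  ultimately show ?thesis by (rule that)
qed

text \<open>The complement \<open>S\<close> of the triple has corank two. An element
  \<open>e\<close> of the hyperplane of \<open>X''\<close> that raises the rank of \<open>S\<close>
  spans this hyperplane together with \<open>S\<close>, so \<open>X''\<close> is the only cocircuit
  avoiding both.\<close>

lemma modular_triple_separating:
  assumes "modular_triple M X X' X''"
  obtains e where "e \<in> X" "e \<in> X'"
    "\<And>Y. Y \<in> cocircuits M \<Longrightarrow> Y \<subseteq> X \<union> X' \<union> X'' \<Longrightarrow> e \<notin> Y \<Longrightarrow> Y = X''"
proof -
  let ?E = "ground M"
  have coc: "X \<in> cocircuits M" "X' \<in> cocircuits M" "X'' \<in> cocircuits M"
    and ne: "X \<noteq> X''" "X' \<noteq> X''"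
    using assms by (auto simp: modular_triple_def modular_set_def)
  define S where "S = ?E - \<Union>{X, X', X''}"
  \<comment> \<open>The rank of the contraction is a truncated difference; being 2, it is
    exact.\<close>
  have S: "rk ?E = Suc (Suc (rk S))"
    using assms rank_contract[of S] by (auto simp: modular_triple_def modular_set_def S_def)
  have "rk S < rk (?E - X'')" using S rk_hyperplane[OF coc(3)] by simp
  then obtain e where e: "e \<in> ?E - X''" "rk (insert e S) = Suc (rk S)"
    using rk_insert_strict[of S "?E - X''"] by (auto simp: S_def)
  have unique: "Y = X''" if "Y \<in> cocircuits M" "Y \<subseteq> X \<union> X' \<union> X''" "e \<notin> Y" for Y
    using that e S coc by (intro cocircuit_avoiding_unique[of Y X'' "insert e S"]) (auto simp: S_def)
  \<comment> \<open>If \<open>X\<close> or \<open>X'\<close> missed \<open>e\<close>, it would equal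
    \<open>X''\<close>.\<close>
  show ?thesis using unique[of X] unique[of X'] unique coc ne by (intro that[of e]) auto
qed

end

section \<open>Chain groups\<close>

context ring
begin

lemma chain_group_linear_combination:
  assumes "chain_group R E C" "finite A" "\<And>X. X \<in> A \<Longrightarrow> a X \<in> C" "r \<in> A \<rightarrow> carrier R"
  shows "(\<lambda>e\<in>E. \<Oplus>X\<in>A. r X \<otimes> a X e) \<in> C"
  using assms(2-)
proof (induction A rule: finite_induct)
  case empty
  then show ?case using assms(1) by (simp add: chain_group_def chain_zero_def[symmetric])
next
  case (insert X A)
  let ?s = "\<lambda>e\<in>E. \<Oplus>X\<in>A. r X \<otimes> a X e"
  have car: "a Y e \<in> carrier R" if "Y \<in> insert X A" "e \<in> E" for Y e
    using insert.prems(1)[OF that(1)] that(2) assms(1) by (auto simp: chain_group_def chains_def)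
  have "?s \<in> C" by (rule insert.IH) (use insert.prems in auto)
  moreover have "r X \<in> carrier R" "a X \<in> C" using insert.prems by auto
  ultimately have "chain_add R E (chain_smult R E (r X) (a X)) ?s \<in> C"
    using assms(1) unfolding chain_group_def by blast
  also have "chain_add R E (chain_smult R E (r X) (a X)) ?s
      = (\<lambda>e\<in>E. \<Oplus>X\<in>insert X A. r X \<otimes> a X e)"
    using insert car unfolding chain_add_def chain_smult_def
    by (intro restrict_ext) (subst finsum_insert, auto)
  finally show ?case .
qed

lemma chain_spanI:
  "r \<in> A \<rightarrow> carrier R \<Longrightarrow> c = (\<lambda>e\<in>E. \<Oplus>X\<in>A. r X \<otimes> a X e) \<Longrightarrow> c \<in> chain_span R E A a"
  unfolding chain_span_def by blast

lemma chain_spanE: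
  assumes "c \<in> chain_span R E A a"
  obtains r where "r \<in> A \<rightarrow> carrier R" "c = (\<lambda>e\<in>E. \<Oplus>X\<in>A. r X \<otimes> a X e)"
  using assms unfolding chain_span_def by blast

lemma chain_span_subset:
  assumes "chain_group R E C" "finite A" "\<And>X. X \<in> A \<Longrightarrow> a X \<in> C"
  shows "chain_span R E A a \<subseteq> C"
  using chain_group_linear_combination[OF assms] by (auto simp: chain_span_def)

lemma generator_in_chain_span:
  assumes "finite A" "\<And>X. X \<in> A \<Longrightarrow> a X \<in> chains R E" "X \<in> A"
  shows "a X \<in> chain_span R E A a"
proof -
  let ?r = "\<lambda>Y. if X = Y then \<one> else \<zero>"
  have car: "a Y e \<in> carrier R" if "Y \<in> A" "e \<in> E" for Y e
    using assms(2)[OF that(1)] that(2) by (auto simp: chains_def)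
  have "(\<Oplus>Y\<in>A. ?r Y \<otimes> a Y e) = a X e" if e: "e \<in> E" for e
  proof -
    have "(\<Oplus>Y\<in>A. ?r Y \<otimes> a Y e) = (\<Oplus>Y\<in>A. if X = Y then a Y e else \<zero>)"
      using car e by (intro finsum_cong') auto
    also have "\<dots> = a X e" using car e assms by (intro finsum_singleton) auto
    finally show ?thesis .
  qed
  moreover have "a X \<in> extensional E" using assms(2)[OF assms(3)] by (auto simp: chains_def PiE_def)
  ultimately have "a X = (\<lambda>e\<in>E. \<Oplus>Y\<in>A. ?r Y \<otimes> a Y e)"
    by (intro extensionalityI[where A = E]) auto
  then show ?thesis by (intro chain_spanI) auto
qed

text \<open>Coefficients multiply from the left, so sums of combinations are absorbed by
  distributivity and left scalars by associativity.\<close>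

lemma chain_group_chain_span:
  assumes "finite A" "\<And>X. X \<in> A \<Longrightarrow> a X \<in> chains R E"
  shows "chain_group R E (chain_span R E A a)"
proof -
  have car: "a Y e \<in> carrier R" if "Y \<in> A" "e \<in> E" for Y e
    using assms(2)[OF that(1)] that(2) by (auto simp: chains_def)
  have "chain_zero R E \<in> chain_span R E A a"
  proof -
    have "(\<Oplus>X\<in>A. \<zero> \<otimes> a X e) = \<zero>" if "e \<in> E" for e
    proof -
      have "(\<Oplus>X\<in>A. \<zero> \<otimes> a X e) = (\<Oplus>X\<in>A. \<zero>)" using that car by (intro finsum_cong') auto
      then show ?thesis by simp
    qed
    then have "chain_zero R E = (\<lambda>e\<in>E. \<Oplus>X\<in>A. \<zero> \<otimes> a X e)"
      unfolding chain_zero_def by (intro restrict_ext) simp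
    then show ?thesis by (intro chain_spanI) auto
  qed
  moreover have "chain_add R E c d \<in> chain_span R E A a"
    if c: "c \<in> chain_span R E A a" and d: "d \<in> chain_span R E A a" for c d
  proof -
    obtain r where r: "r \<in> A \<rightarrow> carrier R" "c = (\<lambda>e\<in>E. \<Oplus>X\<in>A. r X \<otimes> a X e)"
      using c by (rule chain_spanE)
    obtain s where s: "s \<in> A \<rightarrow> carrier R" "d = (\<lambda>e\<in>E. \<Oplus>X\<in>A. s X \<otimes> a X e)"
      using d by (rule chain_spanE)
    have "(\<Oplus>X\<in>A. r X \<otimes> a X e) \<oplus> (\<Oplus>X\<in>A. s X \<otimes> a X e) = (\<Oplus>X\<in>A. (r X \<oplus> s X) \<otimes> a X e)"
      if e: "e \<in> E" for e
    proof -
      have "(\<Oplus>X\<in>A. (r X \<oplus> s X) \<otimes> a X e) = (\<Oplus>X\<in>A. r X \<otimes> a X e \<oplus> s X \<otimes> a X e)"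
        using r(1) s(1) car e by (intro finsum_cong') (auto simp: l_distr Pi_iff)
      then show ?thesis using r(1) s(1) car e by (subst (asm) finsum_addf) (auto simp: Pi_iff)
    qed
    then have "chain_add R E c d = (\<lambda>e\<in>E. \<Oplus>X\<in>A. (r X \<oplus> s X) \<otimes> a X e)"
      unfolding chain_add_def r s by (intro restrict_ext) simp
    then show ?thesis using r(1) s(1) by (intro chain_spanI) auto
  qed
  moreover have "chain_smult R E t c \<in> chain_span R E A a"
    if t: "t \<in> carrier R" and c: "c \<in> chain_span R E A a" for t c
  proof -
    obtain r where r: "r \<in> A \<rightarrow> carrier R" "c = (\<lambda>e\<in>E. \<Oplus>X\<in>A. r X \<otimes> a X e)"
      using c by (rule chain_spanE)
    have "t \<otimes> (\<Oplus>X\<in>A. r X \<otimes> a X e) = (\<Oplus>X\<in>A. (t \<otimes> r X) \<otimes> a X e)" if e: "e \<in> E" for e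
    proof -
      have "(\<Oplus>X\<in>A. (t \<otimes> r X) \<otimes> a X e) = (\<Oplus>X\<in>A. t \<otimes> (r X \<otimes> a X e))"
        using r(1) car e t by (intro finsum_cong') (auto simp: m_assoc Pi_iff)
      then show ?thesis
        using r(1) car e t assms(1) by (subst finsum_rdistr) (auto simp: Pi_iff)
    qed
    then have "chain_smult R E t c = (\<lambda>e\<in>E. \<Oplus>X\<in>A. (t \<otimes> r X) \<otimes> a X e)"
      unfolding chain_smult_def r by (intro restrict_ext) simp
    then show ?thesis using r(1) t by (intro chain_spanI) auto
  qed
  moreover have "chain_span R E A a \<subseteq> chains R E"
    using car by (auto simp: chain_span_def chains_def Pi_iff intro!: finsum_closed m_closed)
  ultimately show ?thesis by (simp add: chain_group_def)
qed

text \<open>The condition is left-linear in \<open>c\<close>, because the entries \<open>c b\<close>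
  stand to the left of the fixed weights. With normalised fundamental chains as weights, it will
  force a chain vanishing on a base to be zero.\<close>

lemma chain_group_determined_on:
  assumes "finite B" "B \<subseteq> E" "\<And>b e. b \<in> B \<Longrightarrow> e \<in> E \<Longrightarrow> w b e \<in> carrier R"
  shows "chain_group R E {c \<in> chains R E. \<forall>e\<in>E. c e = (\<Oplus>b\<in>B. c b \<otimes> w b e)}"
    (is "chain_group R E ?K")
proof -
  have inE: "b \<in> E" if "b \<in> B" for b using that assms(2) by auto
  have car: "c e \<in> carrier R" if "c \<in> ?K" "e \<in> E" for c e
    using that unfolding chains_def by blast
  have "chain_zero R E \<in> ?K"
  proof -
    have "(\<Oplus>b\<in>B. chain_zero R E b \<otimes> w b e) = \<zero>" if "e \<in> E" for e
    proof -
      have "(\<Oplus>b\<in>B. chain_zero R E b \<otimes> w b e) = (\<Oplus>b\<in>B. \<zero>)"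
        using that assms(3) inE by (intro finsum_cong') (auto simp: chain_zero_def)
      then show ?thesis by simp
    qed
    then show ?thesis by (auto simp: chain_zero_def chains_def)
  qed
  moreover have "chain_add R E c d \<in> ?K" if cd: "c \<in> ?K" "d \<in> ?K" for c d
  proof -
    have "c e \<oplus> d e = (\<Oplus>b\<in>B. chain_add R E c d b \<otimes> w b e)" if e: "e \<in> E" for e
    proof -
      have "(\<Oplus>b\<in>B. chain_add R E c d b \<otimes> w b e) = (\<Oplus>b\<in>B. c b \<otimes> w b e \<oplus> d b \<otimes> w b e)"
        using car[OF cd(1)] car[OF cd(2)] assms(3) e inE
        by (intro finsum_cong') (auto simp: chain_add_def l_distr)
      also have "\<dots> = (\<Oplus>b\<in>B. c b \<otimes> w b e) \<oplus> (\<Oplus>b\<in>B. d b \<otimes> w b e)"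
        using car[OF cd(1)] car[OF cd(2)] assms(3) e inE by (intro finsum_addf) auto
      finally show ?thesis using cd e by simp
    qed
    then show ?thesis using car[OF cd(1)] car[OF cd(2)] by (auto simp: chain_add_def chains_def)
  qed
  moreover have "chain_smult R E r c \<in> ?K" if r: "r \<in> carrier R" and c: "c \<in> ?K" for r c
  proof -
    have "r \<otimes> c e = (\<Oplus>b\<in>B. chain_smult R E r c b \<otimes> w b e)" if e: "e \<in> E" for e
    proof -
      have "(\<Oplus>b\<in>B. chain_smult R E r c b \<otimes> w b e) = (\<Oplus>b\<in>B. r \<otimes> (c b \<otimes> w b e))"
        using car[OF c] assms(3) e inE r
        by (intro finsum_cong') (auto simp: chain_smult_def m_assoc)
      also have "\<dots> = r \<otimes> (\<Oplus>b\<in>B. c b \<otimes> w b e)"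
        using car[OF c] assms e inE r by (intro finsum_rdistr[symmetric]) auto
      finally show ?thesis using c e by simp
    qed
    then show ?thesis using car[OF c] r by (auto simp: chain_smult_def chains_def)
  qed
  ultimately show ?thesis by (auto simp: chain_group_def)
qed

text \<open>Gaussian elimination at \<open>e\<close>. The multiplier acts from the left with
  \<open>inv (d e)\<close> next to \<open>d\<close>, so it cancels at \<open>e\<close> without
  commutativity.\<close>

lemma eliminate:
  assumes C: "chain_group R E C" and cd: "c \<in> C" "d \<in> C" and e: "e \<in> E" "d e \<in> Units R"
  obtains c' where "c' \<in> C" "c' e = \<zero>"
    "\<And>f. f \<in> E \<Longrightarrow> c' f = c f \<ominus> c e \<otimes> inv (d e) \<otimes> d f"
proof -
  have car: "x f \<in> carrier R" if "x \<in> C" "f \<in> E" for x f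
    using that C by (auto simp: chain_group_def chains_def)
  let ?t = "c e \<otimes> inv (d e)"
  let ?c = "chain_add R E c (chain_smult R E (\<ominus> ?t) d)"
  have t: "?t \<in> carrier R" using car cd e by simp
  then have "?c \<in> C" using C cd by (simp add: chain_group_def)
  moreover have f: "?c f = c f \<ominus> ?t \<otimes> d f" if "f \<in> E" for f
    using that t car cd by (simp add: chain_add_def chain_smult_def a_minus_def l_minus)
  moreover have "?c e = \<zero>"
    using f[OF e(1)] e car cd by (simp add: m_assoc a_minus_def r_neg)
  ultimately show ?thesis using that by blast
qed

end

section \<open>Chains on the cocircuits of a matroid\<close>

locale cocircuit_chains = ring R + finite_matroid M
  for R :: "('r, 'm) ring_scheme" (structure) and M :: "'e matroid" +
  fixes G :: "'r set" and a :: "'e set \<Rightarrow> 'e \<Rightarrow> 'r"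
  assumes subgroup_G: "subgroup G (units_of R)"
    and minus_one_G: "\<ominus> \<one> \<in> G"
    and primitive_a: "X \<in> cocircuits M \<Longrightarrow> primitive_chain R G (ground M) (a X)"
    and supp_a: "X \<in> cocircuits M \<Longrightarrow> supp R (ground M) (a X) = X"
begin

abbreviation "E \<equiv> ground M"
abbreviation "C \<equiv> chain_span R E (cocircuits M) a"

section \<open>The group \<open>G\<close> and the generating chains\<close>

lemma G_Units: "g \<in> G \<Longrightarrow> g \<in> Units R"
  using subgroup.subset[OF subgroup_G] by (auto simp: units_of_carrier)

lemma G_carrier: "g \<in> G \<Longrightarrow> g \<in> carrier R"
  using G_Units by blast

lemma G_mult: "g \<in> G \<Longrightarrow> h \<in> G \<Longrightarrow> g \<otimes> h \<in> G"
  using subgroup.m_closed[OF subgroup_G] by (simp add: units_of_mult)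

lemma G_inv: "g \<in> G \<Longrightarrow> inv g \<in> G"
  using subgroup.m_inv_closed[OF subgroup_G, of g] units_of_inv[OF G_Units] by simp

lemma G_minus: "g \<in> G \<Longrightarrow> \<ominus> g \<in> G"
  using G_mult[OF minus_one_G] G_carrier by (fastforce simp: l_minus)

lemma a_in_chains: "X \<in> cocircuits M \<Longrightarrow> a X \<in> chains R E"
  using primitive_a by (simp add: primitive_chain_def)

lemma a_closed: "X \<in> cocircuits M \<Longrightarrow> e \<in> E \<Longrightarrow> a X e \<in> carrier R"
  using a_in_chains by (fastforce simp: chains_def)

lemma a_in_G: "X \<in> cocircuits M \<Longrightarrow> e \<in> X \<Longrightarrow> a X e \<in> G"
  using primitive_a[of X] supp_a[of X] by (auto simp: primitive_chain_def supp_def)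

lemma a_nonzero: "X \<in> cocircuits M \<Longrightarrow> e \<in> X \<Longrightarrow> a X e \<noteq> \<zero>"
  using supp_a[of X] by (auto simp: supp_def)

lemma a_zero: "X \<in> cocircuits M \<Longrightarrow> e \<in> E \<Longrightarrow> e \<notin> X \<Longrightarrow> a X e = \<zero>"
  using supp_a[of X] by (auto simp: supp_def)

lemma chain_group_C: "chain_group R E C"
  using finite_cocircuits a_in_chains by (rule chain_group_chain_span)

lemma a_in_C: "X \<in> cocircuits M \<Longrightarrow> a X \<in> C"
  using finite_cocircuits a_in_chains by (rule generator_in_chain_span)

lemma C_closed: "c \<in> C \<Longrightarrow> e \<in> E \<Longrightarrow> c e \<in> carrier R"
  using chain_group_C by (fastforce simp: chain_group_def chains_def)

lemma chain_eqI:
  assumes "c \<in> chains R E" "d \<in> chains R E" "\<And>e. e \<in> E \<Longrightarrow> c e = d e"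
  shows "c = d"
  using assms unfolding chains_def by (intro extensionalityI[where A = E]) (auto simp: PiE_def)

lemma C_in_chains: "c \<in> C \<Longrightarrow> c \<in> chains R E"
  using chain_group_C by (auto simp: chain_group_def)

lemma chain_zero_in_chains: "chain_zero R E \<in> chains R E"
  by (auto simp: chain_zero_def chains_def)

lemma eq_chain_zero_iff: "c \<in> C \<Longrightarrow> c = chain_zero R E \<longleftrightarrow> supp R E c = {}"
  using chain_eqI[OF C_in_chains chain_zero_in_chains, of c]
  by (auto simp: supp_def chain_zero_def)

lemma a_not_chain_zero: "X \<in> cocircuits M \<Longrightarrow> a X \<noteq> chain_zero R E"
  using eq_chain_zero_iff[OF a_in_C] supp_a cocircuit_nonempty by simp

section \<open>Supports of chains and the matroid of \<open>C\<close>\<close>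

definition supports_contain_cocircuits :: bool where
  "supports_contain_cocircuits \<longleftrightarrow>
     (\<forall>c \<in> C. c \<noteq> chain_zero R E \<longrightarrow> (\<exists>X \<in> cocircuits M. X \<subseteq> supp R E c))"

text \<open>Induction on the size of the support. If the cocircuit found inside misses
  \<open>f\<close>, subtract a multiple of its chain to cancel one of its elements: the support
  shrinks, and the entry at \<open>f\<close> is unchanged.\<close>

lemma cocircuit_through_support:
  assumes "supports_contain_cocircuits" "c \<in> C" "f \<in> supp R E c"
  shows "\<exists>X \<in> cocircuits M. f \<in> X \<and> X \<subseteq> supp R E c"
  using assms(2,3)
proof (induction "card (supp R E c)" arbitrary: c rule: less_induct)
  case less
  have fin: "finite (supp R E c)" using finite_ground by (auto simp: supp_def)
  obtain X where X: "X \<in> cocircuits M" "X \<subseteq> supp R E c"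
    using assms(1) less.prems eq_chain_zero_iff unfolding supports_contain_cocircuits_def by blast
  show ?case
  proof (cases "f \<in> X")
    case False
    obtain e where e: "e \<in> X" using cocircuit_nonempty[OF X(1)] by auto
    have eE: "e \<in> E" using e cocircuit_subset_ground[OF X(1)] by auto
    obtain c' where c': "c' \<in> C" "c' e = \<zero>"
      "\<And>g. g \<in> E \<Longrightarrow> c' g = c g \<ominus> c e \<otimes> inv (a X e) \<otimes> a X g"
      using eliminate[OF chain_group_C less.prems(1) a_in_C[OF X(1)] eE] a_in_G[OF X(1) e] G_Units
      by blast
    have off: "c' g = c g" if "g \<in> E" "g \<notin> X" for g
      using c'(3)[OF that(1)] a_zero[OF X(1) that] C_closed[OF less.prems(1)] that eE
        G_Units[OF a_in_G[OF X(1) e]] by (simp add: a_minus_def)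
    have sub: "supp R E c' \<subseteq> supp R E c - {e}"
      using off X(2) c'(2) unfolding supp_def by fastforce
    then have "card (supp R E c') < card (supp R E c)"
      using fin e X(2) by (intro psubset_card_mono) auto
    moreover have "f \<in> supp R E c'" using less.prems(2) off False by (auto simp: supp_def)
    ultimately have "\<exists>Y \<in> cocircuits M. f \<in> Y \<and> Y \<subseteq> supp R E c'"
      using less.hyps c'(1) by blast
    then show ?thesis using sub by blast
  qed (use X in blast)
qed

text \<open>Eliminating \<open>e\<close> leaves a chain whose support is a proper subset of
  \<open>X\<close>. It contains no cocircuit, so that chain is zero.\<close>

lemma multiple_of_cocircuit_chain:
  assumes "supports_contain_cocircuits" "c \<in> C" and X: "X \<in> cocircuits M" "supp R E c \<subseteq> X" "e \<in> X"
  shows "c = chain_smult R E (c e \<otimes> inv (a X e)) (a X)"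
proof -
  have eE: "e \<in> E" using X cocircuit_subset_ground[OF X(1)] by auto
  have u: "a X e \<in> Units R" using a_in_G[OF X(1,3)] G_Units by blast
  obtain c' where c': "c' \<in> C" "c' e = \<zero>"
    "\<And>g. g \<in> E \<Longrightarrow> c' g = c g \<ominus> c e \<otimes> inv (a X e) \<otimes> a X g"
    using eliminate[OF chain_group_C assms(2) a_in_C[OF X(1)] eE u] by blast
  have "c' g = \<zero>" if "g \<in> E" "g \<notin> X" for g
    using c'(3)[OF that(1)] a_zero[OF X(1) that] C_closed[OF assms(2)] X(2) that eE u
    by (auto simp: a_minus_def supp_def)
  then have "supp R E c' \<subseteq> X - {e}" using c'(2) by (auto simp: supp_def)
  then have zero: "c' = chain_zero R E"
    using assms(1) c'(1) cocircuit_antichain[OF X(1)] X(3) unfolding supports_contain_cocircuits_def by blast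
  show ?thesis
  proof (rule chain_eqI)
    show "c \<in> chains R E" using assms(2) by (rule C_in_chains)
    show "chain_smult R E (c e \<otimes> inv (a X e)) (a X) \<in> chains R E"
      using C_closed[OF assms(2) eE] u a_closed[OF X(1)] by (auto simp: chain_smult_def chains_def)
  next
    fix g assume g: "g \<in> E"
    have "c g \<ominus> c e \<otimes> inv (a X e) \<otimes> a X g = \<zero>"
      using c'(3)[OF g] zero g by (simp add: chain_zero_def)
    moreover have "c g = (c g \<ominus> c e \<otimes> inv (a X e) \<otimes> a X g) \<oplus> c e \<otimes> inv (a X e) \<otimes> a X g"
      using g C_closed[OF assms(2)] a_closed[OF X(1) g] u eE by (simp add: a_minus_def a_assoc l_neg)
    ultimately show "c g = chain_smult R E (c e \<otimes> inv (a X e)) (a X) g"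
      using g C_closed[OF assms(2)] a_closed[OF X(1) g] u eE by (simp add: chain_smult_def)
  qed
qed

text \<open>A nonzero chain supported properly inside \<open>X\<close> would yield a cocircuit
  properly inside \<open>X\<close>.\<close>

lemma elementary_chain_of_cocircuit:
  assumes "supports_contain_cocircuits" "X \<in> cocircuits M"
  shows "a X \<in> elementary_chains R E C"
proof -
  have "\<not> supp R E d \<subset> X" if "d \<in> C" "d \<noteq> chain_zero R E" for d
    using assms that cocircuit_antichain[OF assms(2)] unfolding supports_contain_cocircuits_def by blast
  then show ?thesis
    using a_in_C a_not_chain_zero assms supp_a by (auto simp: elementary_chains_def)
qed

text \<open>A cocircuit inside the support is the support of a generator, so by minimality it is the
  whole support.\<close>

lemma supp_elementary_chain:
  assumes "supports_contain_cocircuits" "c \<in> elementary_chains R E C"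
  shows "supp R E c \<in> cocircuits M"
proof -
  have c: "c \<in> C" "c \<noteq> chain_zero R E"
    and min: "\<And>d. d \<in> C \<Longrightarrow> d \<noteq> chain_zero R E \<Longrightarrow> \<not> supp R E d \<subset> supp R E c"
    using assms(2) by (auto simp: elementary_chains_def)
  obtain X where X: "X \<in> cocircuits M" "X \<subseteq> supp R E c"
    using assms(1) c unfolding supports_contain_cocircuits_def by blast
  then have "\<not> X \<subset> supp R E c" using min[OF a_in_C a_not_chain_zero] supp_a by auto
  then show ?thesis using X by auto
qed

text \<open>For one direction, below every nonzero chain lies an elementary one, whose support is a
  cocircuit. For the other, an elementary chain is supported on a cocircuit and hence is a left
  multiple of the primitive chain given there.\<close>

lemma pf_chain_group_iff_supports:
  "pf_chain_group R G E C \<and> is_matroid_of R E C M \<longleftrightarrow> supports_contain_cocircuits"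
proof
  assume "pf_chain_group R G E C \<and> is_matroid_of R E C M"
  then have coc: "cocircuits M = supp R E ` elementary_chains R E C" by (simp add: is_matroid_of_def)
  show supports_contain_cocircuits
    unfolding supports_contain_cocircuits_def
  proof (intro ballI impI)
    fix c assume c: "c \<in> C" "c \<noteq> chain_zero R E"
    \<comment> \<open>A chain satisfying \<open>?P\<close> with smallest support is elementary,
      since any nonzero chain with smaller support inside it would satisfy \<open>?P\<close>
      too.\<close>
    let ?P = "\<lambda>d. d \<in> C \<and> d \<noteq> chain_zero R E \<and> supp R E d \<subseteq> supp R E c"
    have "?P c" using c by simp
    then obtain d where d: "?P d" and least: "\<And>d'. ?P d' \<Longrightarrow> card (supp R E d) \<le> card (supp R E d')"
      using ex_has_least_nat[of ?P c "\<lambda>d. card (supp R E d)"] by blast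
    have "\<not> supp R E d' \<subset> supp R E d" if "d' \<in> C" "d' \<noteq> chain_zero R E" for d'
    proof
      assume less: "supp R E d' \<subset> supp R E d"
      have "finite (supp R E d)" using finite_ground by (simp add: supp_def)
      then have "card (supp R E d') < card (supp R E d)" using less by (rule psubset_card_mono)
      moreover have "card (supp R E d) \<le> card (supp R E d')" using that less d by (intro least) auto
      ultimately show False by simp
    qed
    then have "d \<in> elementary_chains R E C" using d by (auto simp: elementary_chains_def)
    then show "\<exists>X\<in>cocircuits M. X \<subseteq> supp R E c" using coc d by blast
  qed
next
  assume min: supports_contain_cocircuits
  have "\<exists>r\<in>carrier R. \<exists>c'\<in>C. primitive_chain R G E c' \<and> c = chain_smult R E r c'"
    if c: "c \<in> elementary_chains R E C" for c
  proof -
    let ?X = "supp R E c"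
    have X: "?X \<in> cocircuits M" using supp_elementary_chain[OF min c] .
    obtain e where e: "e \<in> ?X" using cocircuit_nonempty[OF X] by auto
    have cC: "c \<in> C" using c by (simp add: elementary_chains_def)
    have "c = chain_smult R E (c e \<otimes> inv (a ?X e)) (a ?X)"
      using multiple_of_cocircuit_chain[OF min cC X order_refl e] .
    moreover have "c e \<otimes> inv (a ?X e) \<in> carrier R"
      using C_closed[OF cC] e cocircuit_subset_ground[OF X] G_carrier[OF G_inv[OF a_in_G[OF X e]]]
      by auto
    ultimately show ?thesis using a_in_C[OF X] primitive_a[OF X] by blast
  qed
  then have "pf_chain_group R G E C" using chain_group_C by (simp add: pf_chain_group_def)
  moreover have "cocircuits M = supp R E ` elementary_chains R E C"
    using elementary_chain_of_cocircuit[OF min] supp_elementary_chain[OF min] supp_a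
    by (auto simp: image_iff) metis
  ultimately show "pf_chain_group R G E C \<and> is_matroid_of R E C M"
    using is_matroid by (simp add: is_matroid_of_def)
qed

section \<open>Relations on modular triples\<close>

definition modular_relation :: "'e set \<Rightarrow> 'e set \<Rightarrow> 'e set \<Rightarrow> bool" where
  "modular_relation X X' X'' \<longleftrightarrow>
     (\<exists>p \<in> G. \<exists>p' \<in> G. \<exists>p'' \<in> G.
        chain_add R E
          (chain_add R E (chain_smult R E p (a X)) (chain_smult R E p' (a X')))
          (chain_smult R E p'' (a X'')) = chain_zero R E)"

text \<open>Cancel \<open>a X\<close> against \<open>a X'\<close> at the separating element
  \<open>e\<close>. The support of the result is a union of cocircuits avoiding \<open>e\<close>,
  all equal to \<open>X''\<close>, so the result is a multiple of \<open>a X''\<close>.\<close>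

lemma modular_relation_if_supports:
  assumes min: supports_contain_cocircuits and triple: "modular_triple M X X' X''"
  shows "modular_relation X X' X''"
proof -
  have X: "X \<in> cocircuits M" and X': "X' \<in> cocircuits M" and X'': "X'' \<in> cocircuits M"
    and ne: "X \<noteq> X'"
    using triple by (auto simp: modular_triple_def modular_set_def)
  obtain e where e: "e \<in> X" "e \<in> X'"
    and unique: "\<And>Y. Y \<in> cocircuits M \<Longrightarrow> Y \<subseteq> X \<union> X' \<union> X'' \<Longrightarrow> e \<notin> Y \<Longrightarrow> Y = X''"
    using modular_triple_separating[OF triple] by blast
  have eE: "e \<in> E" using e cocircuit_subset_ground[OF X] by auto
  \<comment> \<open>The two chains are scaled to take the values 1 and -1 at
    \<open>e\<close>.\<close>
  define p where "p = inv (a X e)"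
  define p' where "p' = \<ominus> (inv (a X' e))"
  have pG: "p \<in> G" "p' \<in> G" using e X X' a_in_G G_inv G_minus by (auto simp: p_def p'_def)
  note pcar = pG[THEN G_carrier]
  define c where "c = chain_add R E (chain_smult R E p (a X)) (chain_smult R E p' (a X'))"
  have "c \<in> C" using chain_group_C a_in_C[OF X] a_in_C[OF X'] pcar by (simp add: c_def chain_group_def)
  have c_at: "c f = p \<otimes> a X f \<oplus> p' \<otimes> a X' f" if "f \<in> E" for f
    using that by (simp add: c_def chain_add_def chain_smult_def)
  have "c e = \<zero>"
    using c_at[OF eE] G_Units[OF a_in_G[OF X e(1)]] G_Units[OF a_in_G[OF X' e(2)]] a_closed[OF X' eE]
    by (simp add: p_def p'_def l_minus r_neg)
  have "supp R E c \<subseteq> X \<union> X'"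
  proof
    fix f assume f: "f \<in> supp R E c"
    show "f \<in> X \<union> X'"
    proof (rule ccontr)
      assume "f \<notin> X \<union> X'"
      then have "c f = \<zero>" using f c_at[of f] a_zero[OF X] a_zero[OF X'] pcar by (simp add: supp_def)
      then show False using f by (simp add: supp_def)
    qed
  qed
  have supp_c: "supp R E c \<subseteq> X''"
  proof
    fix f assume "f \<in> supp R E c"
    then obtain Y where "Y \<in> cocircuits M" "f \<in> Y" "Y \<subseteq> supp R E c"
      using cocircuit_through_support[OF min \<open>c \<in> C\<close>] by blast
    moreover from this have "Y = X''"
      using \<open>supp R E c \<subseteq> X \<union> X'\<close> \<open>c e = \<zero>\<close> by (intro unique) (auto simp: supp_def)
    ultimately show "f \<in> X''" by simp
  qed
  \<comment> \<open>At an element of \<open>X\<close> outside \<open>X'\<close> only the first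
    summand survives, so the entry of \<open>c\<close> is a product of elements of \<open>G\<close>.
    This puts the factor \<open>q\<close> in \<open>G\<close> and not merely in the ring.\<close>
  obtain g where g: "g \<in> X" "g \<notin> X'" using cocircuit_antichain[OF X' X] ne by blast
  have gE: "g \<in> E" using g cocircuit_subset_ground[OF X] by auto
  have cg: "c g = p \<otimes> a X g"
    using c_at[OF gE] a_zero[OF X' gE g(2)] pcar a_closed[OF X gE] by simp
  have "c g \<noteq> \<zero>"
  proof
    assume "c g = \<zero>"
    then have "a X e \<otimes> (p \<otimes> a X g) = \<zero>" using cg a_closed[OF X eE] by simp
    moreover have "a X e \<otimes> (p \<otimes> a X g) = a X g"
      using G_Units[OF a_in_G[OF X e(1)]] a_closed[OF X gE] a_closed[OF X eE]
      by (simp add: p_def m_assoc[symmetric])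
    ultimately show False using a_nonzero[OF X g(1)] by simp
  qed
  then have gX'': "g \<in> X''" using supp_c gE by (auto simp: supp_def)
  define q where "q = c g \<otimes> inv (a X'' g)"
  have qG: "q \<in> G" using cg pG a_in_G[OF X g(1)] a_in_G[OF X'' gX''] by (simp add: q_def G_mult G_inv)
  have c_eq: "c = chain_smult R E q (a X'')"
    unfolding q_def using multiple_of_cocircuit_chain[OF min \<open>c \<in> C\<close> X'' supp_c gX''] .
  have "c f \<oplus> (\<ominus> q) \<otimes> a X'' f = \<zero>" if f: "f \<in> E" for f
  proof -
    have "c f = q \<otimes> a X'' f" using c_eq f by (metis chain_smult_def restrict_apply')
    then show ?thesis using G_carrier[OF qG] a_closed[OF X'' f] by (simp add: l_minus r_neg)
  qed
  then have "chain_add R E c (chain_smult R E (\<ominus> q) (a X'')) = chain_zero R E"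
    unfolding chain_add_def chain_smult_def chain_zero_def by (intro restrict_ext) simp
  then show ?thesis unfolding modular_relation_def c_def using pG G_minus[OF qG] by blast
qed

text \<open>As \<open>p\<close> is a unit, the relation can be solved for \<open>a X\<close>. The
  chain group \<open>K\<close> is arbitrary, so that the lemma applies to chains satisfying a linear
  condition.\<close>

lemma modular_relation_in_chain_group:
  assumes "chain_group R E K" "modular_relation X X' X''" "a X' \<in> K" "a X'' \<in> K"
    and X: "X \<in> cocircuits M"
  shows "a X \<in> K"
proof -
  obtain p p' p'' where p: "p \<in> G" "p' \<in> G" "p'' \<in> G"
    and rel: "chain_add R E
          (chain_add R E (chain_smult R E p (a X)) (chain_smult R E p' (a X')))
          (chain_smult R E p'' (a X'')) = chain_zero R E"
    using assms(2) by (auto simp: modular_relation_def)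
  note pcar = p[THEN G_carrier]
  have car: "a X' f \<in> carrier R" "a X'' f \<in> carrier R" if "f \<in> E" for f
    using that assms(1,3,4) by (auto simp: chain_group_def chains_def)
  let ?d = "chain_add R E (chain_smult R E p' (a X')) (chain_smult R E p'' (a X''))"
  let ?c = "chain_smult R E (\<ominus> (inv p)) ?d"
  have cK: "?c \<in> K" using assms(1,3,4) pcar G_Units[OF p(1)] by (simp add: chain_group_def)
  have "a X = ?c"
  proof (rule chain_eqI)
    show "a X \<in> chains R E" using a_in_chains[OF X] .
    show "?c \<in> chains R E" using cK assms(1) by (auto simp: chain_group_def)
  next
    fix f assume f: "f \<in> E"
    let ?u = "p \<otimes> a X f" and ?v = "p' \<otimes> a X' f \<oplus> p'' \<otimes> a X'' f"
    have uv: "?u \<in> carrier R" "?v \<in> carrier R" using pcar car f a_closed[OF X f] by auto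
    have "?u \<oplus> p' \<otimes> a X' f \<oplus> p'' \<otimes> a X'' f = \<zero>"
      using fun_cong[OF rel, of f] f by (simp add: chain_add_def chain_smult_def chain_zero_def)
    then have "?u \<oplus> ?v = \<zero>" using pcar car f a_closed[OF X f] by (simp add: a_assoc)
    then have "?u = \<ominus> ?v" using minus_equality uv by metis
    then have "inv p \<otimes> ?u = inv p \<otimes> (\<ominus> ?v)" by simp
    moreover have "inv p \<otimes> ?u = a X f"
      using G_Units[OF p(1)] a_closed[OF X f] pcar by (simp add: m_assoc[symmetric])
    moreover have "inv p \<otimes> (\<ominus> ?v) = (\<ominus> (inv p)) \<otimes> ?v"
      using uv G_Units[OF p(1)] by (simp add: l_minus r_minus)
    ultimately have "a X f = (\<ominus> (inv p)) \<otimes> ?v" by simp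
    then show "a X f = ?c f" using f by (simp add: chain_add_def chain_smult_def)
  qed
  then show ?thesis using cK by simp
qed

text \<open>Every chain of \<open>C\<close> is recovered from its entries on \<open>B\<close> by the
  weights \<open>w\<close>, so zero entries on \<open>B\<close> force the zero chain.\<close>

lemma chain_vanishing_on_base:
  assumes rel: "\<And>X X' X''. modular_triple M X X' X'' \<Longrightarrow> modular_relation X X' X''"
    and B: "B \<in> bases M" and c: "c \<in> C" "\<And>b. b \<in> B \<Longrightarrow> c b = \<zero>"
  shows "c = chain_zero R E"
proof -
  have Bi: "B \<in> indeps M" "B \<subseteq> E" "finite B"
    using B base_iff indep_subset_ground finite_indep by blast+
  \<comment> \<open>The choice is harmless: at most one cocircuit meets \<open>B\<close> in exactly
    \<open>b\<close>.\<close>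
  define fund where "fund b = (SOME X. X \<in> cocircuits M \<and> X \<inter> B = {b})" for b
  \<comment> \<open>The fundamental chain of \<open>b\<close>, scaled from the left to be 1 at
    \<open>b\<close>. The default zero keeps the weights in the ring for every
    \<open>b\<close>.\<close>
  define w where "w b e = (if \<exists>X \<in> cocircuits M. X \<inter> B = {b}
    then inv (a (fund b) b) \<otimes> a (fund b) e else \<zero>)" for b e
  have fund: "fund b = X" if "X \<in> cocircuits M" "X \<inter> B = {b}" for X b
    using someI[of "\<lambda>X. X \<in> cocircuits M \<and> X \<inter> B = {b}" X] that
      fundamental_cocircuit_unique[OF B] unfolding fund_def by blast
  have w_eq: "w b e = inv (a X b) \<otimes> a X e" if "X \<in> cocircuits M" "X \<inter> B = {b}" for X b e
    using fund[OF that] that by (auto simp: w_def)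
  have w_closed: "w b e \<in> carrier R" if e: "e \<in> E" for b e
  proof (cases "\<exists>X \<in> cocircuits M. X \<inter> B = {b}")
    case True
    then obtain X where X: "X \<in> cocircuits M" "X \<inter> B = {b}" by blast
    then have "inv (a X b) \<in> carrier R" using G_carrier[OF G_inv[OF a_in_G[OF X(1)]]] by blast
    then show ?thesis using w_eq[OF X] a_closed[OF X(1) e] by simp
  qed (simp add: w_def)
  txt \<open>
    Being the combination of the fundamental chains with the coefficients read off on \<open>B\<close> is a linear
    condition, so it passes from the generators to all of \<open>C\<close>.
  \<close>
  define K where "K = {c \<in> chains R E. \<forall>e\<in>E. c e = (\<Oplus>b\<in>B. c b \<otimes> w b e)}"
  have K: "chain_group R E K"
    unfolding K_def using Bi w_closed by (intro chain_group_determined_on) auto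
  have "a X \<in> K" if "X \<in> cocircuits M" for X
    using that
  \<comment> \<open>A modular triple trades \<open>X\<close> for two cocircuits sharing fewer
    elements with \<open>B\<close>; the induction ends at fundamental cocircuits.\<close>
  proof (induction "card (X \<inter> B)" arbitrary: X rule: less_induct)
    case less
    note X = less.prems
    show ?case
    proof (cases "1 < card (X \<inter> B)")
      case True
      obtain X' X'' where t: "modular_triple M X X' X''" "X' \<inter> B \<subset> X \<inter> B" "X'' \<inter> B \<subset> X \<inter> B"
        using modular_triple_through[OF B X True] by blast
      have "card (X' \<inter> B) < card (X \<inter> B)" "card (X'' \<inter> B) < card (X \<inter> B)"
        using t Bi by (auto intro: psubset_card_mono)
      moreover have "X' \<in> cocircuits M" "X'' \<in> cocircuits M"
        using t by (auto simp: modular_triple_def modular_set_def)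
      ultimately show ?thesis
        using modular_relation_in_chain_group[OF K rel[OF t(1)] _ _ X] less.hyps by blast
    next
      case False
      \<comment> \<open>Every cocircuit meets every base, so exactly one shared element
        remains.\<close>
      moreover have "card (X \<inter> B) \<noteq> 0" using cocircuit_meets_base[OF X B] Bi by simp
      ultimately have "card (X \<inter> B) = 1" by linarith
      then obtain b where b: "X \<inter> B = {b}" by (auto simp: card_1_singleton_iff)
      then have bX: "b \<in> X" "b \<in> B" "b \<in> E" using Bi by auto
      have "a X e = (\<Oplus>b\<in>B. a X b \<otimes> w b e)" if e: "e \<in> E" for e
      proof -
        \<comment> \<open>Base elements other than \<open>b\<close> lie off \<open>X\<close> and get
          coefficient zero; at \<open>b\<close> the coefficient undoes the normalisation.\<close>
        have "a X b' \<otimes> w b' e = (if b = b' then a X e else \<zero>)" if "b' \<in> B" for b'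
        proof (cases "b = b'")
          case True
          have "a X b \<otimes> (inv (a X b) \<otimes> a X e) = a X e"
            using G_Units[OF a_in_G[OF X bX(1)]] a_closed[OF X e] a_closed[OF X bX(3)]
            by (simp add: m_assoc[symmetric])
          then show ?thesis using True w_eq[OF X b] by simp
        next
          case False
          then have "a X b' = \<zero>" using that b Bi by (intro a_zero[OF X]) auto
          then show ?thesis using False w_closed[OF e] by simp
        qed
        then have "(\<Oplus>b\<in>B. a X b \<otimes> w b e) = (\<Oplus>b'\<in>B. if b = b' then a X e else \<zero>)"
          using a_closed[OF X e] by (intro finsum_cong') auto
        also have "\<dots> = a X e" using bX(2) Bi(3) a_closed[OF X e] by (intro finsum_singleton) auto
        finally show ?thesis by simp
      qed
      then show ?thesis using a_in_chains[OF X] by (simp add: K_def)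
    qed
  qed
  then have "C \<subseteq> K" using chain_span_subset[OF K finite_cocircuits] by blast
  then have cK: "\<forall>e\<in>E. c e = (\<Oplus>b\<in>B. c b \<otimes> w b e)" using c by (auto simp: K_def)
  have "c e = \<zero>" if e: "e \<in> E" for e
  proof -
    have "(\<Oplus>b\<in>B. c b \<otimes> w b e) = (\<Oplus>b\<in>B. \<zero>)"
      using c(2) w_closed[OF e] by (intro finsum_cong') auto
    then show ?thesis using cK e by simp
  qed
  then show ?thesis using eq_chain_zero_iff[OF c(1)] by (auto simp: supp_def)
qed

text \<open>A support containing no cocircuit is independent in the dual and so misses a base. The
  chain then vanishes on that base.\<close>

lemma supports_if_modular_relation:
  assumes rel: "\<And>X X' X''. modular_triple M X X' X'' \<Longrightarrow> modular_relation X X' X''"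
  shows supports_contain_cocircuits
  unfolding supports_contain_cocircuits_def
proof (intro ballI impI, rule ccontr)
  fix c assume c: "c \<in> C" "c \<noteq> chain_zero R E" "\<not> (\<exists>X\<in>cocircuits M. X \<subseteq> supp R E c)"
  have "supp R E c \<in> indeps (dual M)"
    using c indeps_dual_iff[OF is_matroid] by (auto simp: supp_def)
  then obtain B where B: "B \<in> bases M" "supp R E c \<inter> B = {}" by (auto simp: dual_def)
  have "B \<subseteq> E" using B base_iff indep_subset_ground by blast
  then have "c b = \<zero>" if "b \<in> B" for b using B that by (auto simp: supp_def)
  then show False using chain_vanishing_on_base[OF rel B(1) c(1)] c(2) by blast
qed

end

theorem theorem3p20:
  fixes M :: "'e matroid"
    and R :: "('r, 'm) ring_scheme"
    and G :: "'r set"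
    and E :: "'e set"
    and a :: "'e set \<Rightarrow> 'e \<Rightarrow> 'r"
    and C :: "('e \<Rightarrow> 'r) set"
  assumes "is_matroid M"
    and "E = ground M"
    and "skew_partial_field R G"
    and "\<And>X. X \<in> cocircuits M \<Longrightarrow> primitive_chain R G E (a X) \<and> supp R E (a X) = X"
    and "C = chain_span R E (cocircuits M) a"
  shows "pf_chain_group R G E C \<and> is_matroid_of R E C M \<longleftrightarrow>
    (\<forall>X X' X''. modular_triple M X X' X'' \<longrightarrow>
       (\<exists>p \<in> G. \<exists>p' \<in> G. \<exists>p'' \<in> G.
          chain_add R E
            (chain_add R E (chain_smult R E p (a X)) (chain_smult R E p' (a X')))
            (chain_smult R E p'' (a X'')) = chain_zero R E))"
proof -
  interpret ring R using assms(3) by (simp add: skew_partial_field_def)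
  interpret cocircuit_chains R M G a
    using assms by (intro cocircuit_chains.intro cocircuit_chains_axioms.intro finite_matroid.intro ring_axioms)
      (auto simp: skew_partial_field_def)
  \<comment> \<open>\<open>supports_contain_cocircuits\<close> links the two sides; unfolding
    \<open>modular_relation\<close> restores the stated equation.\<close>
  show ?thesis
    using pf_chain_group_iff_supports modular_relation_if_supports
      supports_if_modular_relation
    unfolding assms(2,5) modular_relation_def by blast
qed

end
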